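(* Let $X$ be a compact Hausdorff space and let $A$ be an $\ell$-subalgebra of $C(X)$ which separates points of $X$. Then $A$ is uniformly dense in $C(X)$; that is, for every $h \in C(X)$ and every real $\varepsilon > 0$ there is $a \in A$ with $\|a - h\| \le \varepsilon$.
   Context: $C(X)$ denotes the $\mathbb{R}$-algebra of all continuous functions $X \to \mathbb{R}$, with pointwise operations and pointwise order; it is a lattice under pointwise maximum $\vee$ and minimum $\wedge$. An $\ell$-subalgebra of $C(X)$ is an $\mathbb{R}$-subalgebra (containing the constant functions) which is also a sublattice, i.e. closed under $\vee$ and $\wedge$. $A$ separates points of $X$ if for all distinct $x, y \in X$ there is $a \in A$ with $a(x) \ne a(y)$. The uniform norm is $\|f\| = \sup_{x \in X} |f(x)|$. *)

theory Defs
  imports "HOL-Analysis.Analysis"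
begin

(* Elements of C(X) are taken extensional on the carrier, so that two of them are
   equal in HOL iff they agree on topspace X; the pointwise operations are
   restricted to the carrier accordingly. *)

definition cont_funs :: "'a topology \<Rightarrow> ('a \<Rightarrow> real) set" where
  "cont_funs X = {f \<in> extensional (topspace X). continuous_map X euclideanreal f}"

definition l_subalgebra :: "'a topology \<Rightarrow> ('a \<Rightarrow> real) set \<Rightarrow> bool" where
  "l_subalgebra X A \<longleftrightarrow>
     A \<subseteq> cont_funs X \<and>
     (\<forall>c. (\<lambda>x\<in>topspace X. c) \<in> A) \<and>
     (\<forall>f\<in>A. \<forall>g\<in>A. (\<lambda>x\<in>topspace X. f x + g x) \<in> A) \<and>
     (\<forall>f\<in>A. \<forall>g\<in>A. (\<lambda>x\<in>topspace X. f x * g x) \<in> A) \<and>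
     (\<forall>c. \<forall>f\<in>A. (\<lambda>x\<in>topspace X. c * f x) \<in> A) \<and>
     (\<forall>f\<in>A. \<forall>g\<in>A. (\<lambda>x\<in>topspace X. max (f x) (g x)) \<in> A) \<and>
     (\<forall>f\<in>A. \<forall>g\<in>A. (\<lambda>x\<in>topspace X. min (f x) (g x)) \<in> A)"

definition separates_points :: "'a topology \<Rightarrow> ('a \<Rightarrow> real) set \<Rightarrow> bool" where
  "separates_points X A \<longleftrightarrow>
     (\<forall>x\<in>topspace X. \<forall>y\<in>topspace X. x \<noteq> y \<longrightarrow> (\<exists>a\<in>A. a x \<noteq> a y))"

(* The supremum is taken in the nonnegative reals, hence 0 for the empty space, where
   the real-valued Sup is unspecified. It is likewise meaningful only for
   functions bounded on the carrier, such as continuous ones on a compact space. *)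

definition uniform_norm :: "'a topology \<Rightarrow> ('a \<Rightarrow> real) \<Rightarrow> real" where
  "uniform_norm X f = (if topspace X = {} then 0 else (SUP x\<in>topspace X. \<bar>f x\<bar>))"

definition uniformly_dense :: "'a topology \<Rightarrow> ('a \<Rightarrow> real) set \<Rightarrow> bool" where
  "uniformly_dense X A \<longleftrightarrow>
     (\<forall>h\<in>cont_funs X. \<forall>\<epsilon>>0. \<exists>a\<in>A. uniform_norm X (\<lambda>x\<in>topspace X. a x - h x) \<le> \<epsilon>)"

end

theory Submission
  imports Defs
begin

text \<open>
  This is the lattice version of the Stone--Weierstrass theorem. Separation of points and the
  constants let A interpolate h at any two points. Fixing one of them, finite maxima of
  interpolants stay equal to h there and, by compactness, can be made to exceed h - \<epsilon> everywhere;
  finite minima of such functions then also stay below h + \<epsilon>.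
\<close>

text \<open>Compactness leaves finitely many \<open>U s\<close>, and directedness absorbs their
  union into a single one. Pairwise maxima and minima thus suffice later, with no lattice operation
  over a finite family.\<close>

lemma compact_space_directed_cover:
  assumes "compact_space X" and "S \<noteq> {}"
    and opn: "\<And>s. s \<in> S \<Longrightarrow> openin X (U s)"
    and cov: "\<And>x. x \<in> topspace X \<Longrightarrow> \<exists>s\<in>S. x \<in> U s"
    and dir: "\<And>s t. s \<in> S \<Longrightarrow> t \<in> S \<Longrightarrow> \<exists>u\<in>S. U s \<union> U t \<subseteq> U u"
  obtains s where "s \<in> S" and "topspace X \<subseteq> U s"
proof -
  have "topspace X \<subseteq> \<Union>(U ` S)"
    using cov by blast
  then obtain \<F> where "finite \<F>" "\<F> \<subseteq> U ` S" and sub: "topspace X \<subseteq> \<Union>\<F>"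
    using \<open>compact_space X\<close> opn unfolding compact_space_alt by (metis (no_types, lifting) imageE)
  then obtain F where F: "finite F" "F \<subseteq> S" and \<F>: "\<F> = U ` F"
    by (meson finite_subset_image)
  from F have "\<exists>s\<in>S. \<Union>(U ` F) \<subseteq> U s"
  proof (induction F rule: finite_induct)
    case empty
    \<comment> \<open>The empty union names no member, so any element of \<open>S\<close> will
      do.\<close>
    with \<open>S \<noteq> {}\<close> show ?case by auto
  next
    case (insert t F)
    then obtain s where s: "s \<in> S" "\<Union>(U ` F) \<subseteq> U s" by auto
    obtain u where "u \<in> S" "U t \<union> U s \<subseteq> U u"
      using dir[of t s] insert.prems s(1) by auto
    with s(2) show ?case by auto
  qed
  then obtain s where "s \<in> S" "\<Union>(U ` F) \<subseteq> U s" ..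
  with sub show thesis
    unfolding \<F> by (intro that[of s]) simp_all
qed

lemma openin_less_continuous_map:
  fixes f g :: "'a \<Rightarrow> real"
  assumes "continuous_map X euclideanreal f" and "continuous_map X euclideanreal g"
  shows "openin X {x \<in> topspace X. f x < g x}"
  using openin_continuous_map_preimage[OF continuous_map_diff[OF assms(2,1)], of "{0<..}"]
  by simp

lemma l_subalgebraD:
  assumes "l_subalgebra X A"
  shows "f \<in> A \<Longrightarrow> continuous_map X euclideanreal f"
    and "(\<lambda>x\<in>topspace X. c) \<in> A"
    and "f \<in> A \<Longrightarrow> g \<in> A \<Longrightarrow> (\<lambda>x\<in>topspace X. f x + g x) \<in> A"
    and "f \<in> A \<Longrightarrow> (\<lambda>x\<in>topspace X. c * f x) \<in> A"
    and "f \<in> A \<Longrightarrow> g \<in> A \<Longrightarrow> (\<lambda>x\<in>topspace X. max (f x) (g x)) \<in> A"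
    and "f \<in> A \<Longrightarrow> g \<in> A \<Longrightarrow> (\<lambda>x\<in>topspace X. min (f x) (g x)) \<in> A"
  using assms by (simp_all add: l_subalgebra_def cont_funs_def subset_iff)

lemma l_subalgebra_interpolate:
  assumes A: "l_subalgebra X A" and "separates_points X A"
    and x: "x \<in> topspace X" and y: "y \<in> topspace X"
  obtains f where "f \<in> A" and "f x = h x" and "f y = h y"
proof (cases "x = y")
  case True
  show thesis
    by (rule that[of "\<lambda>z\<in>topspace X. h x"])
       (use x True in \<open>simp_all add: l_subalgebraD(2)[OF A]\<close>)
next
  case False
  then obtain a where a: "a \<in> A" and ne: "a x \<noteq> a y"
    using assms unfolding separates_points_def by blast
  \<comment> \<open>The interpolant is affine in \<open>a\<close>: \<open>c\<close> is the slope of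
    the line through (\<open>a x\<close>, \<open>h x\<close>) and (\<open>a y\<close>,
    \<open>h y\<close>), and \<open>h x - c * a x\<close> is its intercept.\<close>
  define c where "c = (h y - h x) / (a y - a x)"
  have c: "c * (a y - a x) = h y - h x"
    using ne by (simp add: c_def)
  have "(\<lambda>z\<in>topspace X. (\<lambda>z\<in>topspace X. c * a z) z + (\<lambda>z\<in>topspace X. h x - c * a x) z) \<in> A"
    by (intro l_subalgebraD[OF A] a)
  then show thesis
    by (rule that) (use x y c in \<open>simp_all add: algebra_simps\<close>)
qed

text \<open>The cover is indexed by the members of \<open>A\<close> pinned to \<open>h\<close> at
  \<open>x\<close>; two-point interpolation at \<open>x\<close> and \<open>y\<close> puts
  \<open>y\<close> into some \<open>U s\<close>. The pinned value is kept in the conclusion because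
  the covering in the two-sided approximation rests on it.\<close>

lemma l_subalgebra_approx_above:
  assumes X: "compact_space X" and A: "l_subalgebra X A" and sep: "separates_points X A"
    and h: "continuous_map X euclideanreal h" and e: "0 < e" and x: "x \<in> topspace X"
  obtains g where "g \<in> A" and "g x = h x" and "\<And>z. z \<in> topspace X \<Longrightarrow> h z - e < g z"
proof -
  define S where "S = {f \<in> A. f x = h x}"
  define U where "U f = {z \<in> topspace X. h z - e < f z}" for f
  have cov: "\<exists>s\<in>S. y \<in> U s" if y: "y \<in> topspace X" for y
  proof -
    obtain f where "f \<in> A" "f x = h x" "f y = h y"
      using l_subalgebra_interpolate[OF A sep x y, of h] by blast
    with y e show ?thesis by (intro bexI[of _ f]) (auto simp: S_def U_def)
  qed
  then have S: "S \<noteq> {}"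
    using x by blast
  have opn: "openin X (U s)" if "s \<in> S" for s
    unfolding U_def
    by (intro openin_less_continuous_map continuous_map_diff h)
       (use that l_subalgebraD(1)[OF A] in \<open>simp_all add: S_def\<close>)
  \<comment> \<open>The maximum keeps the common value \<open>h x\<close> at \<open>x\<close> and
    exceeds \<open>h - e\<close> wherever \<open>s\<close> or \<open>t\<close> does.\<close>
  have dir: "\<exists>u\<in>S. U s \<union> U t \<subseteq> U u" if "s \<in> S" "t \<in> S" for s t
    by (rule bexI[of _ "\<lambda>z\<in>topspace X. max (s z) (t z)"])
       (use that x in \<open>auto simp: S_def U_def l_subalgebraD(5)[OF A]\<close>)
  obtain g where "g \<in> S" "topspace X \<subseteq> U g"
    by (rule compact_space_directed_cover[OF X S opn cov dir])
  then show thesis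
    by (intro that[of g]) (auto simp: S_def U_def)
qed

text \<open>Dual argument: the index set now holds the functions already above \<open>h - e\<close>.
  A point \<open>y\<close> is covered by the one pinned at \<open>y\<close>, since
  \<open>h y < h y + e\<close>.\<close>

lemma l_subalgebra_approx:
  assumes X: "compact_space X" and A: "l_subalgebra X A" and sep: "separates_points X A"
    and h: "continuous_map X euclideanreal h" and e: "0 < e"
  obtains g where "g \<in> A" and "\<And>z. z \<in> topspace X \<Longrightarrow> \<bar>g z - h z\<bar> < e"
proof (cases "topspace X = {}")
  case True
  \<comment> \<open>On an empty carrier there is no point at which to pin a function, so a constant
    serves as witness.\<close>
  have "(\<lambda>x\<in>topspace X. 0) \<in> A"
    by (rule l_subalgebraD(2)[OF A])
  then show thesis
    by (rule that) (simp add: True)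
next
  case False
  define S where "S = {f \<in> A. \<forall>z\<in>topspace X. h z - e < f z}"
  define U where "U f = {z \<in> topspace X. f z < h z + e}" for f
  have cov: "\<exists>s\<in>S. y \<in> U s" if y: "y \<in> topspace X" for y
  proof -
    obtain g where "g \<in> A" "g y = h y" "\<And>z. z \<in> topspace X \<Longrightarrow> h z - e < g z"
      using l_subalgebra_approx_above[OF X A sep h e y] by blast
    with y e show ?thesis by (intro bexI[of _ g]) (auto simp: S_def U_def)
  qed
  then have S: "S \<noteq> {}"
    using False by blast
  have opn: "openin X (U s)" if "s \<in> S" for s
    unfolding U_def
    by (intro openin_less_continuous_map continuous_map_add h)
       (use that l_subalgebraD(1)[OF A] in \<open>simp_all add: S_def\<close>)
  \<comment> \<open>The minimum stays above \<open>h - e\<close> and is below \<open>h + e\<close>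
    wherever \<open>s\<close> or \<open>t\<close> is.\<close>
  have dir: "\<exists>u\<in>S. U s \<union> U t \<subseteq> U u" if "s \<in> S" "t \<in> S" for s t
    by (rule bexI[of _ "\<lambda>z\<in>topspace X. min (s z) (t z)"])
       (use that in \<open>auto simp: S_def U_def l_subalgebraD(6)[OF A]\<close>)
  obtain g where "g \<in> S" "topspace X \<subseteq> U g"
    by (rule compact_space_directed_cover[OF X S opn cov dir])
  then have "g \<in> A" and "\<forall>z\<in>topspace X. h z - e < g z \<and> g z < h z + e"
    by (auto simp: S_def U_def)
  then show thesis
    by (intro that[of g]) (simp_all add: abs_diff_less_iff)
qed

lemma uniform_norm_le:
  assumes "0 \<le> e" and "\<And>x. x \<in> topspace X \<Longrightarrow> \<bar>f x\<bar> \<le> e"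
  shows "uniform_norm X f \<le> e"
  \<comment> \<open>The bound \<open>0 \<le> e\<close> settles the empty carrier, where the norm is
    0 by definition.\<close>
  using assms by (auto simp: uniform_norm_def intro: cSUP_least)

theorem theorem3p7:
  fixes X :: "'a topology" and A :: "('a \<Rightarrow> real) set"
  assumes "compact_space X" and "Hausdorff_space X"
    and "l_subalgebra X A"
    and "separates_points X A"
  shows "uniformly_dense X A"
  unfolding uniformly_dense_def
proof (intro ballI allI impI)
  fix h and e :: real
  assume "h \<in> cont_funs X" and e: "0 < e"
  then have "continuous_map X euclideanreal h"
    by (simp add: cont_funs_def)
  from l_subalgebra_approx[OF assms(1,3,4) this e]
  obtain g where "g \<in> A" and g: "\<And>z. z \<in> topspace X \<Longrightarrow> \<bar>g z - h z\<bar> < e"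
    by blast
  \<comment> \<open>Passing to the supremum weakens the strict pointwise bound to
    \<open>\<le>\<close>.\<close>
  moreover have "uniform_norm X (\<lambda>x\<in>topspace X. g x - h x) \<le> e"
    using e g by (intro uniform_norm_le) (auto intro: less_imp_le)
  ultimately show "\<exists>a\<in>A. uniform_norm X (\<lambda>x\<in>topspace X. a x - h x) \<le> e"
    by blast
qed

end
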